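(* Let ${}^{*}X$ be a directed functional extension of $X$, endowed with the Star-topology. Then ${}^{*}X$ is a coherent analytic topological extension of $X$: namely ${}^{*}X$ is a $T_1$ space, $X$ is dense in ${}^{*}X$, every ${}^{*}f$ ($f:X\to X$) is continuous, and the following hold for all $f,g:X\to X$: (c) ${}^{*}g\circ{}^{*}f={}^{*}(g\circ f)$; (i) if $f(x)=x$ for all $x\in A\subseteq X$ then ${}^{*}f(\xi)=\xi$ for all $\xi$ in the closure $\overline{A}$ of $A$ in ${}^{*}X$; (d) if $f(x)\neq g(x)$ for all $x\in X$ then ${}^{*}f(\xi)\neq{}^{*}g(\xi)$ for all $\xi\in{}^{*}X$; (f) for all $\xi,\eta\in{}^{*}X$ there exist $p,q:X\to X$ and $\zeta\in{}^{*}X$ with ${}^{*}p(\zeta)=\xi$ and ${}^{*}q(\zeta)=\eta$.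
   Context: $X$ is a set with distinct elements $0,1\in X$. A functional extension of $X$ is a superset ${}^{*}X\supseteq X$ with an assignment to each $f:X\to X$ of ${}^{*}f:{}^{*}X\to{}^{*}X$ extending $f$ such that for all $f,g:X\to X$, $\xi\in{}^{*}X$: (comp) ${}^{*}g({}^{*}f(\xi))={}^{*}(g\circ f)(\xi)$; (diag) ${}^{*}(\chi\circ(f,g))(\xi)=1$ if ${}^{*}f(\xi)={}^{*}g(\xi)$ and $0$ otherwise, where $\chi:X\times X\to\{0,1\}$ is the characteristic function of the diagonal and $\chi\circ(f,g)$ is $x\mapsto\chi(f(x),g(x))$. It is directed if for all $\xi,\eta\in{}^{*}X$ there exist $f,g:X\to X$ and $\zeta\in{}^{*}X$ with ${}^{*}f(\zeta)=\xi$, ${}^{*}g(\zeta)=\eta$. The Star-topology on ${}^{*}X$ is the topology whose closed sets are the arbitrary intersections of sets of the form $E(f_1,\dots,f_n;\eta_1,\dots,\eta_n)=\{\xi\in{}^{*}X\mid \exists i\in\{1,\dots,n\}\ {}^{*}f_i(\xi)=\eta_i\}$, for $n\ge1$, functions $f_i:X\to X$ and points $\eta_i\in{}^{*}X$. *)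

theory Defs
  imports "HOL-Analysis.Abstract_Topological_Spaces" "HOL-Library.FuncSet"
begin

text \<open>
  Functions between the carrier sets \<open>A\<close> and \<open>B\<close> are the elements of \<open>A \<rightarrow>\<^sub>E B\<close>, so that
  equality of functions is equality on the domain; \<open>compose A g f\<close> is composition.
\<close>

text \<open>\<open>\<chi> \<circ> (f, g)\<close> for the characteristic function \<open>\<chi>\<close> of the diagonal of \<open>X\<close>,
  where \<open>z\<close> and \<open>u\<close> play the roles of \<open>0\<close> and \<open>1\<close>.\<close>

definition chi_diag :: "'a set \<Rightarrow> 'a \<Rightarrow> 'a \<Rightarrow> ('a \<Rightarrow> 'a) \<Rightarrow> ('a \<Rightarrow> 'a) \<Rightarrow> 'a \<Rightarrow> 'a" where
  "chi_diag X z u f g = (\<lambda>x\<in>X. if f x = g x then u else z)"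

locale functional_extension =
  fixes X :: "'a set" and z u :: 'a
    and Y :: "'a set" and star :: "('a \<Rightarrow> 'a) \<Rightarrow> 'a \<Rightarrow> 'a"
  assumes zero_in: "z \<in> X" and one_in: "u \<in> X" and zero_neq_one: "z \<noteq> u"
    and superset: "X \<subseteq> Y"
    and star_funcset: "f \<in> X \<rightarrow>\<^sub>E X \<Longrightarrow> star f \<in> Y \<rightarrow>\<^sub>E Y"
    and star_extends: "f \<in> X \<rightarrow>\<^sub>E X \<Longrightarrow> x \<in> X \<Longrightarrow> star f x = f x"
    and comp: "f \<in> X \<rightarrow>\<^sub>E X \<Longrightarrow> g \<in> X \<rightarrow>\<^sub>E X \<Longrightarrow> \<xi> \<in> Y \<Longrightarrow>
      star g (star f \<xi>) = star (compose X g f) \<xi>"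
    and diag: "f \<in> X \<rightarrow>\<^sub>E X \<Longrightarrow> g \<in> X \<rightarrow>\<^sub>E X \<Longrightarrow> \<xi> \<in> Y \<Longrightarrow>
      star (chi_diag X z u f g) \<xi> = (if star f \<xi> = star g \<xi> then u else z)"

definition directed_ext :: "'a set \<Rightarrow> 'a set \<Rightarrow> (('a \<Rightarrow> 'a) \<Rightarrow> 'a \<Rightarrow> 'a) \<Rightarrow> bool" where
  "directed_ext X Y star \<longleftrightarrow>
    (\<forall>\<xi>\<in>Y. \<forall>\<eta>\<in>Y. \<exists>f\<in>X \<rightarrow>\<^sub>E X. \<exists>g\<in>X \<rightarrow>\<^sub>E X. \<exists>\<zeta>\<in>Y. star f \<zeta> = \<xi> \<and> star g \<zeta> = \<eta>)"

definition star_E ::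
  "'a set \<Rightarrow> (('a \<Rightarrow> 'a) \<Rightarrow> 'a \<Rightarrow> 'a) \<Rightarrow> nat \<Rightarrow> (nat \<Rightarrow> 'a \<Rightarrow> 'a) \<Rightarrow> (nat \<Rightarrow> 'a) \<Rightarrow> 'a set" where
  "star_E Y star n f \<eta> = {\<xi> \<in> Y. \<exists>i\<in>{1..n}. star (f i) \<xi> = \<eta> i}"

definition star_basic_closed ::
  "'a set \<Rightarrow> 'a set \<Rightarrow> (('a \<Rightarrow> 'a) \<Rightarrow> 'a \<Rightarrow> 'a) \<Rightarrow> 'a set set" where
  "star_basic_closed X Y star =
    {star_E Y star n f \<eta> | n f \<eta>. n \<ge> 1 \<and> (\<forall>i\<in>{1..n}. f i \<in> X \<rightarrow>\<^sub>E X \<and> \<eta> i \<in> Y)}"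

text \<open>The intersection is taken inside \<open>Y\<close>: the empty intersection is \<open>Y\<close>.\<close>

definition star_closed ::
  "'a set \<Rightarrow> 'a set \<Rightarrow> (('a \<Rightarrow> 'a) \<Rightarrow> 'a \<Rightarrow> 'a) \<Rightarrow> 'a set \<Rightarrow> bool" where
  "star_closed X Y star C \<longleftrightarrow> (\<exists>\<E> \<subseteq> star_basic_closed X Y star. C = Y \<inter> \<Inter>\<E>)"

definition star_topology ::
  "'a set \<Rightarrow> 'a set \<Rightarrow> (('a \<Rightarrow> 'a) \<Rightarrow> 'a \<Rightarrow> 'a) \<Rightarrow> 'a topology" where
  "star_topology X Y star = topology (\<lambda>U. U \<subseteq> Y \<and> star_closed X Y star (Y - U))"

definition coherent_analytic_topological_extension ::
  "'a set \<Rightarrow> 'a set \<Rightarrow> (('a \<Rightarrow> 'a) \<Rightarrow> 'a \<Rightarrow> 'a) \<Rightarrow> 'a topology \<Rightarrow> bool" where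
  "coherent_analytic_topological_extension X Y star T \<longleftrightarrow>
    X \<subseteq> Y \<and> topspace T = Y \<and> t1_space T \<and> T closure_of X = Y \<and>
    (\<forall>f\<in>X \<rightarrow>\<^sub>E X. star f \<in> Y \<rightarrow>\<^sub>E Y \<and> (\<forall>x\<in>X. star f x = f x) \<and> continuous_map T T (star f)) \<and>
    \<comment> \<open>(c)\<close>
    (\<forall>f\<in>X \<rightarrow>\<^sub>E X. \<forall>g\<in>X \<rightarrow>\<^sub>E X. compose Y (star g) (star f) = star (compose X g f)) \<and>
    \<comment> \<open>(i)\<close>
    (\<forall>f\<in>X \<rightarrow>\<^sub>E X. \<forall>A\<subseteq>X. (\<forall>x\<in>A. f x = x) \<longrightarrow> (\<forall>\<xi>\<in>T closure_of A. star f \<xi> = \<xi>)) \<and>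
    \<comment> \<open>(d)\<close>
    (\<forall>f\<in>X \<rightarrow>\<^sub>E X. \<forall>g\<in>X \<rightarrow>\<^sub>E X. (\<forall>x\<in>X. f x \<noteq> g x) \<longrightarrow> (\<forall>\<xi>\<in>Y. star f \<xi> \<noteq> star g \<xi>)) \<and>
    \<comment> \<open>(f)\<close>
    (\<forall>\<xi>\<in>Y. \<forall>\<eta>\<in>Y. \<exists>p\<in>X \<rightarrow>\<^sub>E X. \<exists>q\<in>X \<rightarrow>\<^sub>E X. \<exists>\<zeta>\<in>Y. star p \<zeta> = \<xi> \<and> star q \<zeta> = \<eta>)"

text \<open>The sets satisfying \<open>star_closed\<close> are indeed the closed sets of \<open>star_topology\<close>.\<close>

lemma star_basic_closed_Un:
  assumes "E \<in> star_basic_closed X Y star" "F \<in> star_basic_closed X Y star"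
  shows "E \<union> F \<in> star_basic_closed X Y star"
proof -
  obtain n f \<eta> where E: "E = star_E Y star n f \<eta>" "n \<ge> 1"
      "\<forall>i\<in>{1..n}. f i \<in> X \<rightarrow>\<^sub>E X \<and> \<eta> i \<in> Y"
    using assms(1) unfolding star_basic_closed_def by blast
  obtain m g \<theta> where F: "F = star_E Y star m g \<theta>" "m \<ge> 1"
      "\<forall>i\<in>{1..m}. g i \<in> X \<rightarrow>\<^sub>E X \<and> \<theta> i \<in> Y"
    using assms(2) unfolding star_basic_closed_def by blast
  define h where "h i = (if i \<le> n then f i else g (i - n))" for i
  define \<kappa> where "\<kappa> i = (if i \<le> n then \<eta> i else \<theta> (i - n))" for i
  have hi: "h i \<in> X \<rightarrow>\<^sub>E X \<and> \<kappa> i \<in> Y" if "i \<in> {1..n+m}" for i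
  proof (cases "i \<le> n")
    case True then show ?thesis using E(3) that by (simp add: h_def \<kappa>_def)
  next
    case False
    then have "i - n \<in> {1..m}" using that by auto
    then show ?thesis using F(3) False by (simp add: h_def \<kappa>_def)
  qed
  have iff: "(\<exists>i\<in>{1..n+m}. star (h i) \<xi> = \<kappa> i) \<longleftrightarrow>
      (\<exists>i\<in>{1..n}. star (f i) \<xi> = \<eta> i) \<or> (\<exists>i\<in>{1..m}. star (g i) \<xi> = \<theta> i)" (is "?L \<longleftrightarrow> ?R") for \<xi>
  proof
    assume ?L
    then obtain i where i: "i \<in> {1..n+m}" "star (h i) \<xi> = \<kappa> i" by blast
    show ?R
    proof (cases "i \<le> n")
      case True then show ?thesis using i by (auto simp: h_def \<kappa>_def)
    next
      case False
      then have "i - n \<in> {1..m}" using i by auto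
      moreover have "star (g (i - n)) \<xi> = \<theta> (i - n)"
        using i(2) False by (simp add: h_def \<kappa>_def)
      ultimately show ?thesis by blast
    qed
  next
    assume ?R
    then show ?L
    proof
      assume "\<exists>i\<in>{1..n}. star (f i) \<xi> = \<eta> i"
      then obtain i where "i \<in> {1..n}" "star (f i) \<xi> = \<eta> i" by blast
      then show ?L by (intro bexI[of _ i]) (auto simp: h_def \<kappa>_def)
    next
      assume "\<exists>i\<in>{1..m}. star (g i) \<xi> = \<theta> i"
      then obtain i where "i \<in> {1..m}" "star (g i) \<xi> = \<theta> i" by blast
      then show ?L by (intro bexI[of _ "n + i"]) (auto simp: h_def \<kappa>_def)
    qed
  qed
  have "E \<union> F = star_E Y star (n + m) h \<kappa>"
    unfolding E(1) F(1) star_E_def using iff by auto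
  moreover have "n + m \<ge> 1" using E(2) by simp
  ultimately show ?thesis unfolding star_basic_closed_def using hi by blast
qed

lemma star_closed_Un:
  assumes "star_closed X Y star C" "star_closed X Y star D"
  shows "star_closed X Y star (C \<union> D)"
proof -
  obtain \<C> where C: "\<C> \<subseteq> star_basic_closed X Y star" "C = Y \<inter> \<Inter>\<C>"
    using assms(1) unfolding star_closed_def by blast
  obtain \<D> where D: "\<D> \<subseteq> star_basic_closed X Y star" "D = Y \<inter> \<Inter>\<D>"
    using assms(2) unfolding star_closed_def by blast
  let ?\<E> = "{E \<union> F | E F. E \<in> \<C> \<and> F \<in> \<D>}"
  have "?\<E> \<subseteq> star_basic_closed X Y star"
    using C(1) D(1) star_basic_closed_Un by blast
  moreover have "C \<union> D = Y \<inter> \<Inter>?\<E>"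
    unfolding C(2) D(2) by blast
  ultimately show ?thesis unfolding star_closed_def by blast
qed

lemma star_closed_Inter:
  assumes "\<And>C. C \<in> \<K> \<Longrightarrow> star_closed X Y star C"
  shows "star_closed X Y star (Y \<inter> \<Inter>\<K>)"
proof -
  have "\<forall>C\<in>\<K>. \<exists>\<E>. \<E> \<subseteq> star_basic_closed X Y star \<and> C = Y \<inter> \<Inter>\<E>"
    using assms unfolding star_closed_def by blast
  then obtain e where e: "\<forall>C\<in>\<K>. e C \<subseteq> star_basic_closed X Y star \<and> C = Y \<inter> \<Inter>(e C)"
    by metis
  then have "\<xi> \<in> C \<longleftrightarrow> \<xi> \<in> Y \<and> \<xi> \<in> \<Inter>(e C)" if "C \<in> \<K>" for \<xi> C
    using that by (metis IntE IntI)
  then have "Y \<inter> \<Inter>\<K> = Y \<inter> \<Inter>(\<Union>C\<in>\<K>. e C)" by auto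
  moreover have "(\<Union>C\<in>\<K>. e C) \<subseteq> star_basic_closed X Y star" using e by blast
  ultimately show ?thesis unfolding star_closed_def by blast
qed

context functional_extension
begin

lemma star_const_one:
  assumes "\<xi> \<in> Y" shows "star (\<lambda>x\<in>X. u) \<xi> = u"
proof -
  have id: "(\<lambda>x\<in>X. x) \<in> X \<rightarrow>\<^sub>E X" by auto
  have "chi_diag X z u (\<lambda>x\<in>X. x) (\<lambda>x\<in>X. x) = (\<lambda>x\<in>X. u)"
    by (auto simp: chi_diag_def)
  then show ?thesis using diag[OF id id assms] by simp
qed

lemma star_closed_empty: "star_closed X Y star {}"
proof -
  have "star_E Y star 1 (\<lambda>_. \<lambda>x\<in>X. u) (\<lambda>_. z) = {}"
    using star_const_one zero_neq_one by (auto simp: star_E_def)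
  moreover have "star_E Y star 1 (\<lambda>_. \<lambda>x\<in>X. u) (\<lambda>_. z) \<in> star_basic_closed X Y star"
    unfolding star_basic_closed_def using one_in zero_in superset
    by (intro CollectI exI[of _ 1] exI[of _ "\<lambda>_. \<lambda>x\<in>X. u"] exI[of _ "\<lambda>_. z"]) auto
  ultimately show ?thesis unfolding star_closed_def by (intro exI[of _ "{{}}"]) auto
qed

lemma istopology_star: "istopology (\<lambda>U. U \<subseteq> Y \<and> star_closed X Y star (Y - U))"
  unfolding istopology_def
proof (intro conjI allI impI)
  fix S T assume "S \<subseteq> Y \<and> star_closed X Y star (Y - S)" "T \<subseteq> Y \<and> star_closed X Y star (Y - T)"
  then show "S \<inter> T \<subseteq> Y" "star_closed X Y star (Y - S \<inter> T)"
    using star_closed_Un[of X Y star "Y - S" "Y - T"] by (auto simp: Diff_Int)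
next
  fix \<K> assume K: "\<forall>K\<in>\<K>. K \<subseteq> Y \<and> star_closed X Y star (Y - K)"
  then show "\<Union>\<K> \<subseteq> Y" by blast
  have "star_closed X Y star (Y \<inter> \<Inter>((\<lambda>K. Y - K) ` \<K>))"
    by (rule star_closed_Inter) (use K in blast)
  moreover have "Y \<inter> \<Inter>((\<lambda>K. Y - K) ` \<K>) = Y - \<Union>\<K>" by blast
  ultimately show "star_closed X Y star (Y - \<Union>\<K>)" by (simp only:)
qed

lemma openin_star_topology:
  "openin (star_topology X Y star) U \<longleftrightarrow> U \<subseteq> Y \<and> star_closed X Y star (Y - U)"
  unfolding star_topology_def using topology_inverse'[OF istopology_star] by simp

lemma topspace_star_topology: "topspace (star_topology X Y star) = Y"
proof -
  have "openin (star_topology X Y star) Y"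
    using openin_star_topology star_closed_empty by simp
  then show ?thesis
    using openin_star_topology openin_subset openin_topspace by blast
qed

lemma closedin_star_topology:
  "closedin (star_topology X Y star) C \<longleftrightarrow> star_closed X Y star C"
proof -
  have "C \<subseteq> Y" if "star_closed X Y star C" using that unfolding star_closed_def by blast
  then show ?thesis
    unfolding closedin_def topspace_star_topology openin_star_topology
    by (auto simp: double_diff)
qed

end

end

theory Submission
  imports Defs
begin

text \<open>
  For a point \<open>\<xi>\<close> of the extension call \<open>A \<subseteq> X\<close> large if the extension of its characteristic
  function takes the value \<open>1\<close> at \<open>\<xi>\<close>. By (diag), two extended functions agree at \<open>\<xi>\<close> iff their
  equalizer is large, so largeness is additive for symmetric differences; that two disjoint sets
  are never both large then makes the large sets an ultrafilter. Hence a finite cover of \<open>X\<close> by sets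
  \<open>{x. f\<^sub>i x = \<eta>\<^sub>i}\<close> has a large member, which is the density of \<open>X\<close>. Equalizers of extended functions
  are basic closed sets by (diag), which gives (i).
\<close>

context functional_extension
begin

section \<open>Extended constants and indicators, and large sets\<close>

definition charfun :: "'a set \<Rightarrow> 'a \<Rightarrow> 'a" where
  "charfun A = (\<lambda>x\<in>X. if x \<in> A then u else z)"

definition large :: "'a \<Rightarrow> 'a set \<Rightarrow> bool" where
  "large \<xi> A \<longleftrightarrow> star (charfun A) \<xi> = u"

lemma charfun_in [simp]: "charfun A \<in> X \<rightarrow>\<^sub>E X"
  using zero_in one_in by (auto simp: charfun_def)

lemma const_in [simp]: "c \<in> X \<Longrightarrow> (\<lambda>x\<in>X. c) \<in> X \<rightarrow>\<^sub>E X"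
  by auto

text \<open>The constant \<open>c\<close> factors through the constant \<open>u\<close>, whose
  extension is already known to be constant. By (comp) its value at \<open>\<xi>\<close> is the
  value at \<open>u\<close>, and \<open>u\<close> lies in \<open>X\<close>, where the extension
  agrees with the original map.\<close>

lemma star_const:
  assumes "c \<in> X" "\<xi> \<in> Y"
  shows "star (\<lambda>x\<in>X. c) \<xi> = c"
proof -
  have "compose X (\<lambda>x\<in>X. c) (\<lambda>x\<in>X. u) = (\<lambda>x\<in>X. c)"
    using one_in by (auto simp: compose_def)
  then have "star (\<lambda>x\<in>X. c) \<xi> = star (\<lambda>x\<in>X. c) (star (\<lambda>x\<in>X. u) \<xi>)"
    using comp[of "\<lambda>x\<in>X. u" "\<lambda>x\<in>X. c" \<xi>] assms one_in by simp
  also have "\<dots> = c"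
    using star_const_one[OF assms(2)] star_extends[of "\<lambda>x\<in>X. c" u] assms(1) one_in by simp
  finally show ?thesis .
qed

lemma chi_diag_eq_charfun: "chi_diag X z u f g = charfun {x \<in> X. f x = g x}"
  by (auto simp: chi_diag_def charfun_def)

text \<open>This is (diag) read as a bridge: coincidence at a point of \<open>Y\<close> becomes a
  statement about a subset of \<open>X\<close>.\<close>

lemma star_eq_iff_large:
  assumes "f \<in> X \<rightarrow>\<^sub>E X" "g \<in> X \<rightarrow>\<^sub>E X" "\<xi> \<in> Y"
  shows "star f \<xi> = star g \<xi> \<longleftrightarrow> large \<xi> {x \<in> X. f x = g x}"
  using diag[OF assms] zero_neq_one by (auto simp: large_def chi_diag_eq_charfun)

lemma star_eq_const_iff_large:
  assumes "f \<in> X \<rightarrow>\<^sub>E X" "c \<in> X" "\<xi> \<in> Y"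
  shows "star f \<xi> = c \<longleftrightarrow> large \<xi> {x \<in> X. f x = c}"
proof -
  have "{x \<in> X. f x = (\<lambda>x\<in>X. c) x} = {x \<in> X. f x = c}" by auto
  then show ?thesis
    using star_eq_iff_large[of f "\<lambda>x\<in>X. c" \<xi>] assms by (simp add: star_const)
qed

section \<open>Ultrafilter properties of the large sets at a point\<close>

lemma large_space: "\<xi> \<in> Y \<Longrightarrow> large \<xi> X"
  using star_eq_iff_large[OF charfun_in charfun_in, of \<xi> X X] by simp

lemma not_large_empty: "\<xi> \<in> Y \<Longrightarrow> \<not> large \<xi> {}"
  using star_const[OF zero_in, of \<xi>] zero_neq_one by (simp add: large_def charfun_def)

text \<open>An indicator equals \<open>chi_diag\<close> of itself and the constant \<open>u\<close>,
  so (diag) leaves only the values \<open>u\<close> and \<open>z\<close>.\<close>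

lemma star_charfun:
  assumes "\<xi> \<in> Y"
  shows "star (charfun A) \<xi> = (if large \<xi> A then u else z)"
proof -
  have "charfun A = chi_diag X z u (charfun A) (\<lambda>x\<in>X. u)"
    using zero_neq_one by (auto simp: chi_diag_def charfun_def)
  then have "star (charfun A) \<xi> \<in> {z, u}"
    using diag[OF charfun_in const_in[OF one_in] assms, of A] by (auto split: if_splits)
  then show ?thesis by (auto simp: large_def)
qed

text \<open>The set on the left is where the two indicators agree. As their extensions take only two
  values, agreement at \<open>\<xi>\<close> means that both sets are large or neither is.\<close>

lemma large_iff_same:
  assumes "\<xi> \<in> Y"
  shows "large \<xi> {x \<in> X. x \<in> A \<longleftrightarrow> x \<in> B} \<longleftrightarrow> (large \<xi> A \<longleftrightarrow> large \<xi> B)"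
proof -
  have "{x \<in> X. charfun A x = charfun B x} = {x \<in> X. x \<in> A \<longleftrightarrow> x \<in> B}"
    using zero_neq_one by (auto simp: charfun_def)
  then show ?thesis
    using star_eq_iff_large[OF charfun_in charfun_in assms, of A B] zero_neq_one assms
    by (auto simp: star_charfun split: if_splits)
qed

lemma large_Compl:
  assumes "\<xi> \<in> Y"
  shows "large \<xi> (X - A) \<longleftrightarrow> \<not> large \<xi> A"
proof -
  have "{x \<in> X. x \<in> A \<longleftrightarrow> x \<in> {}} = X - A" by auto
  then show ?thesis
    using large_iff_same[OF assms, of A "{}"] not_large_empty[OF assms] by simp
qed

lemma large_disjoint:
  assumes "\<xi> \<in> Y" "A \<subseteq> X" "B \<subseteq> X" "A \<inter> B = {}" "large \<xi> A"
  shows "\<not> large \<xi> B"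
proof
  assume "large \<xi> B"
  then have "A \<noteq> {}" "B \<noteq> {}"
    using assms not_large_empty by auto
  then obtain a b where ab: "a \<in> A" "b \<in> B" by blast
  \<comment> \<open>Collapsing \<open>A\<close> to \<open>a\<close> and \<open>B\<close> to \<open>b\<close>, the extended map would take both values at \<open>\<xi>\<close>.\<close>
  define f where "f = (\<lambda>x\<in>X. if x \<in> A then a else if x \<in> B then b else x)"
  have f: "f \<in> X \<rightarrow>\<^sub>E X" using ab assms by (auto simp: f_def)
  \<comment> \<open>Points outside \<open>A\<close> and \<open>B\<close> are fixed, hence not sent
    to \<open>a\<close> or \<open>b\<close>; the two fibres are therefore exactly \<open>A\<close>
    and \<open>B\<close>.\<close>
  have "{x \<in> X. f x = a} = A" "{x \<in> X. f x = b} = B"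
    using ab assms by (auto simp: f_def split: if_splits)
  then have "star f \<xi> = a" "star f \<xi> = b"
    using star_eq_const_iff_large[OF f _ assms(1)] ab assms \<open>large \<xi> B\<close> by auto
  then show False using ab assms by auto
qed

text \<open>Were \<open>B\<close> not large, the agreement set of \<open>A\<close> and
  \<open>B\<close> would not be large, so its complement \<open>B - A\<close> would be large
  although disjoint from the large set \<open>A\<close>.\<close>

lemma large_mono:
  assumes "\<xi> \<in> Y" "A \<subseteq> B" "B \<subseteq> X" "large \<xi> A"
  shows "large \<xi> B"
proof (rule ccontr)
  assume "\<not> large \<xi> B"
  moreover have "X - {x \<in> X. x \<in> A \<longleftrightarrow> x \<in> B} = B - A" using assms by auto
  ultimately have "large \<xi> (B - A)"
    using large_Compl[OF assms(1), of "{x \<in> X. x \<in> A \<longleftrightarrow> x \<in> B}"] large_iff_same[OF assms(1)] assms(4)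
    by simp
  then show False using large_disjoint[of \<xi> A "B - A"] assms by auto
qed

text \<open>\<open>B\<close> and the union disagree exactly on \<open>A - B\<close>. If only the
  union is large, then so is \<open>A - B\<close>, and monotonicity passes this to
  \<open>A\<close>.\<close>

lemma large_Un:
  assumes "\<xi> \<in> Y" "A \<subseteq> X" "B \<subseteq> X" "large \<xi> (A \<union> B)"
  shows "large \<xi> A \<or> large \<xi> B"
proof (rule disjCI)
  assume "\<not> large \<xi> B"
  moreover have "X - {x \<in> X. x \<in> B \<longleftrightarrow> x \<in> A \<union> B} = A - B" using assms by auto
  ultimately have "large \<xi> (A - B)"
    using large_Compl[OF assms(1), of "{x \<in> X. x \<in> B \<longleftrightarrow> x \<in> A \<union> B}"]
      large_iff_same[OF assms(1), of B "A \<union> B"] assms(4)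
    by simp
  then show "large \<xi> A" using large_mono[of \<xi> "A - B" A] assms by auto
qed

lemma large_finite_UN:
  assumes "finite I" "\<xi> \<in> Y" "\<And>i. i \<in> I \<Longrightarrow> A i \<subseteq> X" "large \<xi> (\<Union>i\<in>I. A i)"
  shows "\<exists>i\<in>I. large \<xi> (A i)"
  using assms
proof (induction I rule: finite_induct)
  case empty
  then show ?case using not_large_empty by simp
next
  case (insert j I)
  then have "large \<xi> (A j) \<or> large \<xi> (\<Union>i\<in>I. A i)"
    by (intro large_Un) auto
  then show ?case using insert by auto
qed

section \<open>Density of \<open>X\<close>\<close>

lemma basic_closed_superset:
  assumes "E \<in> star_basic_closed X Y star" "X \<subseteq> E"
  shows "Y \<subseteq> E"
proof
  fix \<xi> assume \<xi>: "\<xi> \<in> Y"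
  obtain n f \<eta> where E: "E = star_E Y star n f \<eta>"
      and f: "\<And>i. i \<in> {1..n} \<Longrightarrow> f i \<in> X \<rightarrow>\<^sub>E X"
    using assms(1) unfolding star_basic_closed_def by blast
  have "\<exists>i\<in>{1..n}. f i x = \<eta> i" if x: "x \<in> X" for x
  proof -
    have "x \<in> star_E Y star n f \<eta>" using assms(2) x E by blast
    then obtain i where "i \<in> {1..n}" "star (f i) x = \<eta> i"
      unfolding star_E_def by blast
    then show ?thesis using star_extends[OF f x, of i] by auto
  qed
  then have "(\<Union>i\<in>{1..n}. {x \<in> X. f i x = \<eta> i}) = X" by blast
  then have "large \<xi> (\<Union>i\<in>{1..n}. {x \<in> X. f i x = \<eta> i})"
    using large_space[OF \<xi>] by simp
  then obtain i where i: "i \<in> {1..n}" "large \<xi> {x \<in> X. f i x = \<eta> i}"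
    using large_finite_UN[of "{1..n}" \<xi> "\<lambda>i. {x \<in> X. f i x = \<eta> i}"] \<xi> by auto
  then have "{x \<in> X. f i x = \<eta> i} \<noteq> {}" using not_large_empty \<xi> by metis
  \<comment> \<open>A priori \<open>\<eta> i\<close> lies only in \<open>Y\<close>. A large fibre is
    nonempty, so \<open>\<eta> i\<close> is a value of \<open>f i\<close> on \<open>X\<close>, and
    the criterion for constants in \<open>X\<close> applies.\<close>
  then have "\<eta> i \<in> X" using PiE_mem[OF f[OF i(1)]] by force
  then have "star (f i) \<xi> = \<eta> i"
    using star_eq_const_iff_large f i \<xi> by blast
  then show "\<xi> \<in> E" using i \<xi> by (auto simp: E star_E_def)
qed

lemma closure_of_space: "star_topology X Y star closure_of X = Y"
proof
  show "star_topology X Y star closure_of X \<subseteq> Y"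
    using closure_of_subset_topspace topspace_star_topology by metis
  have "star_closed X Y star (star_topology X Y star closure_of X)"
    using closedin_star_topology closedin_closure_of by blast
  then obtain \<E> where \<E>: "\<E> \<subseteq> star_basic_closed X Y star"
      "star_topology X Y star closure_of X = Y \<inter> \<Inter>\<E>"
    unfolding star_closed_def by blast
  have "X \<subseteq> star_topology X Y star closure_of X"
    using superset by (simp add: closure_of_subset topspace_star_topology)
  \<comment> \<open>Each basic closed set cutting out the closure contains \<open>X\<close>, hence
    all of \<open>Y\<close>.\<close>
  then have "Y \<subseteq> E" if "E \<in> \<E>" for E
    using that \<E> basic_closed_superset by blast
  then show "Y \<subseteq> star_topology X Y star closure_of X" using \<E>(2) by blast
qed

section \<open>Closed fibres and equalizers, continuity\<close>

lemma closedin_star_fiber: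
  assumes "f \<in> X \<rightarrow>\<^sub>E X" "\<eta> \<in> Y"
  shows "closedin (star_topology X Y star) {\<xi> \<in> Y. star f \<xi> = \<eta>}"
proof -
  have "{\<xi> \<in> Y. star f \<xi> = \<eta>} = star_E Y star 1 (\<lambda>_. f) (\<lambda>_. \<eta>)"
    by (auto simp: star_E_def)
  then have "{\<xi> \<in> Y. star f \<xi> = \<eta>} \<in> star_basic_closed X Y star"
    unfolding star_basic_closed_def using assms
    by (intro CollectI exI[of _ 1] exI[of _ "\<lambda>_. f"] exI[of _ "\<lambda>_. \<eta>"]) auto
  then show ?thesis
    unfolding closedin_star_topology star_closed_def
    by (intro exI[of _ "{{\<xi> \<in> Y. star f \<xi> = \<eta>}}"]) auto
qed

text \<open>Closed equalizers usually come from a Hausdorff target; here (diag) turns the equalizer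
  into the fibre over \<open>u\<close> of a single extended indicator.\<close>

lemma closedin_star_equalizer:
  assumes "f \<in> X \<rightarrow>\<^sub>E X" "g \<in> X \<rightarrow>\<^sub>E X"
  shows "closedin (star_topology X Y star) {\<xi> \<in> Y. star f \<xi> = star g \<xi>}"
proof -
  have "{\<xi> \<in> Y. star f \<xi> = star g \<xi>} = {\<xi> \<in> Y. star (charfun {x \<in> X. f x = g x}) \<xi> = u}"
    using star_eq_iff_large[OF assms] by (auto simp: large_def)
  then show ?thesis
    using closedin_star_fiber[OF charfun_in, of u] one_in superset by auto
qed

lemma compose_in: "f \<in> X \<rightarrow>\<^sub>E X \<Longrightarrow> g \<in> X \<rightarrow>\<^sub>E X \<Longrightarrow> compose X g f \<in> X \<rightarrow>\<^sub>E X"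
  by (auto simp: compose_def)

text \<open>By (comp), pulling back along \<open>star g\<close> replaces each \<open>f i\<close> by
  its composite with \<open>g\<close> and keeps the points \<open>\<eta> i\<close>. Continuity
  follows since preimages commute with intersections.\<close>

lemma star_basic_closed_vimage:
  assumes "E \<in> star_basic_closed X Y star" "g \<in> X \<rightarrow>\<^sub>E X"
  shows "{\<xi> \<in> Y. star g \<xi> \<in> E} \<in> star_basic_closed X Y star"
proof -
  obtain n f \<eta> where E: "E = star_E Y star n f \<eta>" "n \<ge> 1"
      "\<forall>i\<in>{1..n}. f i \<in> X \<rightarrow>\<^sub>E X \<and> \<eta> i \<in> Y"
    using assms(1) unfolding star_basic_closed_def by blast
  have "star g \<xi> \<in> Y" if "\<xi> \<in> Y" for \<xi>
    using star_funcset[OF assms(2)] that by auto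
  then have "{\<xi> \<in> Y. star g \<xi> \<in> E} = star_E Y star n (\<lambda>i. compose X (f i) g) \<eta>"
    using comp[OF assms(2)] E by (auto simp: star_E_def)
  then show ?thesis
    unfolding star_basic_closed_def using E(2,3) compose_in[OF assms(2)]
    by (intro CollectI exI[of _ n] exI[of _ "\<lambda>i. compose X (f i) g"] exI[of _ \<eta>]) auto
qed

lemma continuous_map_star:
  assumes "g \<in> X \<rightarrow>\<^sub>E X"
  shows "continuous_map (star_topology X Y star) (star_topology X Y star) (star g)"
  unfolding continuous_map_closedin topspace_star_topology closedin_star_topology
proof (intro conjI allI impI)
  show gY: "star g \<in> Y \<rightarrow> Y"
    using star_funcset[OF assms] by auto
  fix C assume "star_closed X Y star C"
  then obtain \<E> where \<E>: "\<E> \<subseteq> star_basic_closed X Y star" "C = Y \<inter> \<Inter>\<E>"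
    unfolding star_closed_def by blast
  have "{\<xi> \<in> Y. star g \<xi> \<in> C} = Y \<inter> \<Inter>((\<lambda>E. {\<xi> \<in> Y. star g \<xi> \<in> E}) ` \<E>)"
    using gY \<E>(2) by auto
  moreover have "(\<lambda>E. {\<xi> \<in> Y. star g \<xi> \<in> E}) ` \<E> \<subseteq> star_basic_closed X Y star"
    using \<E>(1) star_basic_closed_vimage[OF _ assms] by blast
  ultimately show "star_closed X Y star {\<xi> \<in> Y. star g \<xi> \<in> C}"
    unfolding star_closed_def by blast
qed

section \<open>Conditions (c) and (d)\<close>

lemma compose_star:
  assumes "f \<in> X \<rightarrow>\<^sub>E X" "g \<in> X \<rightarrow>\<^sub>E X"
  shows "compose Y (star g) (star f) = star (compose X g f)"
proof (rule extensionalityI[of _ Y])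
  \<comment> \<open>Values on \<open>Y\<close> agree by (comp); equality of functions also requires
    agreement off \<open>Y\<close>, where both sides are \<open>undefined\<close>.\<close>
  show "star (compose X g f) \<in> extensional Y"
    using star_funcset[OF compose_in[OF assms]] by (auto simp: PiE_def)
qed (auto simp: compose_def comp[OF assms, unfolded compose_def])

lemma star_neq:
  assumes "f \<in> X \<rightarrow>\<^sub>E X" "g \<in> X \<rightarrow>\<^sub>E X" "\<forall>x\<in>X. f x \<noteq> g x" "\<xi> \<in> Y"
  shows "star f \<xi> \<noteq> star g \<xi>"
proof -
  have "{x \<in> X. f x = g x} = {}" using assms(3) by auto
  then show ?thesis
    using star_eq_iff_large[OF assms(1,2,4)] not_large_empty[OF assms(4)] by metis
qed

section \<open>Directedness: the T1 property and condition (i)\<close>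

context
  assumes directed: "directed_ext X Y star"
begin

text \<open>By (comp), the extended identity fixes every value of an extended function, and
  directedness makes each point of \<open>Y\<close> such a value.\<close>

lemma star_id:
  assumes "\<xi> \<in> Y"
  shows "star (\<lambda>x\<in>X. x) \<xi> = \<xi>"
proof -
  obtain f \<zeta> where f: "f \<in> X \<rightarrow>\<^sub>E X" "\<zeta> \<in> Y" "star f \<zeta> = \<xi>"
    using directed assms unfolding directed_ext_def by blast
  have "compose X (\<lambda>x\<in>X. x) f = f"
    using f(1) by (intro extensionalityI[of _ X]) (auto simp: compose_def PiE_def)
  then show ?thesis
    using comp[OF f(1) _ f(2), of "\<lambda>x\<in>X. x"] f(3) by auto
qed

lemma t1_space_star_topology: "t1_space (star_topology X Y star)"
  unfolding t1_space_closedin_singleton topspace_star_topology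
proof
  fix \<eta> assume "\<eta> \<in> Y"
  \<comment> \<open>Singletons are fibres of the extended identity, hence closed.\<close>
  moreover from this have "{\<xi> \<in> Y. star (\<lambda>x\<in>X. x) \<xi> = \<eta>} = {\<eta>}"
    using star_id by auto
  ultimately show "closedin (star_topology X Y star) {\<eta>}"
    using closedin_star_fiber[of "\<lambda>x\<in>X. x" \<eta>] by auto
qed

lemma star_fixes_closure:
  assumes "f \<in> X \<rightarrow>\<^sub>E X" "A \<subseteq> X" "\<forall>x\<in>A. f x = x"
    and "\<xi> \<in> star_topology X Y star closure_of A"
  shows "star f \<xi> = \<xi>"
proof -
  \<comment> \<open>The fixed points of \<open>star f\<close> are written as an equalizer with the
    extended identity, so they form a closed set containing \<open>A\<close>.\<close>
  let ?F = "{\<xi> \<in> Y. star f \<xi> = star (\<lambda>x\<in>X. x) \<xi>}"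
  have "closedin (star_topology X Y star) ?F"
    using closedin_star_equalizer[OF assms(1), of "\<lambda>x\<in>X. x"] by auto
  moreover have "A \<subseteq> ?F"
    using assms superset star_extends star_id by auto
  ultimately have "\<xi> \<in> ?F" using assms(4) closure_of_minimal by blast
  then show ?thesis using star_id by simp
qed

end

end

theorem theorem3p2:
  fixes X Y :: "'a set" and z u :: 'a and star :: "('a \<Rightarrow> 'a) \<Rightarrow> 'a \<Rightarrow> 'a"
  assumes "functional_extension X z u Y star"
    and "directed_ext X Y star"
  shows "coherent_analytic_topological_extension X Y star (star_topology X Y star)"
proof -
  interpret functional_extension X z u Y star by (rule assms(1))
  show ?thesis
    unfolding coherent_analytic_topological_extension_def
  proof (intro conjI ballI allI impI)
    show "X \<subseteq> Y" by (rule superset)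
    show "topspace (star_topology X Y star) = Y" by (rule topspace_star_topology)
    show "t1_space (star_topology X Y star)" by (rule t1_space_star_topology[OF assms(2)])
    show "star_topology X Y star closure_of X = Y" by (rule closure_of_space)
  next
    fix \<xi> \<eta> assume "\<xi> \<in> Y" "\<eta> \<in> Y"
    then show "\<exists>p\<in>X \<rightarrow>\<^sub>E X. \<exists>q\<in>X \<rightarrow>\<^sub>E X. \<exists>\<zeta>\<in>Y. star p \<zeta> = \<xi> \<and> star q \<zeta> = \<eta>"
      using assms(2) unfolding directed_ext_def by simp
  qed (fact star_funcset star_extends continuous_map_star compose_star star_neq
      star_fixes_closure[OF assms(2)])+
qed

end
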